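(* For any integer $k\geq 1$, the odd graph $O_{2k+1}$ has a $\mathcal{C}_{2k+1}$-factor.
   Context: The odd graph $O_{2k+1}$ has as vertices all $k$-element subsets of $\{1,2,\ldots,2k+1\}$, with an edge between any two sets that are disjoint. For a graph $G$ with $n$ vertices and a divisor $\ell$ of $n$, a $\mathcal{C}_\ell$-factor of $G$ is a collection of $n/\ell$ pairwise vertex-disjoint cycles in $G$, each of length $\ell$ (so together they cover all vertices). *)

theory Defs
  imports "Graph_Theory.Graph_Theory"
begin

text \<open>
  An undirected simple graph is a symmetric loop-free digraph (locale \<open>pair_graph\<close>): an edge is
  represented by its two opposite arcs. \<open>odd_graph k\<close> is the graph usually written O with index
  2k+1. For k = 0 the only vertex is the empty set, which is disjoint from itself, so only
  \<open>k \<ge> 1\<close> gives a simple graph.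
\<close>

definition odd_graph :: "nat \<Rightarrow> nat set pair_pre_digraph" where
  "odd_graph k =
    (let V = {A. A \<subseteq> {1..2 * k + 1} \<and> card A = k}
     in \<lparr> pverts = V, parcs = {(A, B). A \<in> V \<and> B \<in> V \<and> A \<inter> B = {}} \<rparr>)"

text \<open>
  The library's \<open>cycle\<close> admits the closed walk of length 2 that runs along an edge and back,
  which is not a cycle of an undirected graph; hence the bound \<open>3 \<le> l\<close>.
\<close>

definition is_cycle_of_length :: "('a, 'b) pre_digraph \<Rightarrow> nat \<Rightarrow> 'b awalk \<Rightarrow> bool" where
  "is_cycle_of_length G l p \<longleftrightarrow> pre_digraph.cycle G p \<and> length p = l \<and> 3 \<le> l"

text \<open>Every vertex on a closed walk is the tail of one of its arcs.\<close>

definition cycle_verts :: "('a, 'b) pre_digraph \<Rightarrow> 'b awalk \<Rightarrow> 'a set" where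
  "cycle_verts G p = tail G ` set p"

definition is_cycle_factor :: "('a, 'b) pre_digraph \<Rightarrow> nat \<Rightarrow> 'b awalk set \<Rightarrow> bool" where
  "is_cycle_factor G l F \<longleftrightarrow>
     l dvd card (verts G) \<and> finite F \<and> card F = card (verts G) div l \<and>
     (\<forall>p\<in>F. is_cycle_of_length G l p) \<and>
     (\<forall>p\<in>F. \<forall>q\<in>F. p \<noteq> q \<longrightarrow> cycle_verts G p \<inter> cycle_verts G q = {})"

definition has_cycle_factor :: "('a, 'b) pre_digraph \<Rightarrow> nat \<Rightarrow> bool" where
  "has_cycle_factor G l \<longleftrightarrow> (\<exists>F. is_cycle_factor G l F)"

lemma pair_graph_odd_graph:
  assumes "k \<ge> 1"
  shows "pair_graph (odd_graph k)"
proof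
  have arcD: "A \<in> pverts (odd_graph k) \<and> B \<in> pverts (odd_graph k) \<and> A \<noteq> B
      \<and> (B, A) \<in> parcs (odd_graph k)" if "(A, B) \<in> parcs (odd_graph k)" for A B
  proof -
    have "A \<in> pverts (odd_graph k)" "B \<in> pverts (odd_graph k)" "A \<inter> B = {}" "card A = k"
      using that by (simp_all add: odd_graph_def Let_def)
    moreover from this have "A \<noteq> B"
      using assms by (metis Int_absorb card.empty not_one_le_zero)
    ultimately show ?thesis
      by (simp add: odd_graph_def Let_def Int_commute)
  qed
  have "pverts (odd_graph k) \<subseteq> Pow {1..2 * k + 1}"
    unfolding odd_graph_def Let_def by (simp, blast)
  then show fv: "finite (pverts (odd_graph k))"
    by (rule finite_subset) simp
  have "parcs (odd_graph k) \<subseteq> pverts (odd_graph k) \<times> pverts (odd_graph k)"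
    using arcD by (meson SigmaI subrelI)
  then show "finite (parcs (odd_graph k))"
    by (rule finite_subset) (simp add: fv)
  show "fst e \<in> pverts (odd_graph k)" "snd e \<in> pverts (odd_graph k)" "fst e \<noteq> snd e"
    if "e \<in> parcs (odd_graph k)" for e
    using that arcD[of "fst e" "snd e"] by simp_all
  show "symmetric (with_proj (odd_graph k))"
    unfolding symmetric_def with_proj_simps using arcD by (intro symI) simp
qed

lemma (in pre_digraph) cycle_verts_conv:
  assumes "awalk u p u" "p \<noteq> []"
  shows "cycle_verts G p = set (awalk_verts u p)"
proof -
  have cas: "cas u p u"
    using assms by (simp add: awalk_def)
  have "set (awalk_verts u q) = insert v (tail G ` set q)" if "cas u q v" for u q v
    using that by (induct u q v rule: cas.induct) (simp_all add: insert_commute)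
  from this[OF cas] have "set (awalk_verts u p) = insert u (tail G ` set p)" .
  moreover have "u \<in> tail G ` set p"
    using cas \<open>p \<noteq> []\<close> by (cases p) simp_all
  ultimately show ?thesis
    by (simp add: cycle_verts_def insert_absorb)
qed

lemma (in pre_digraph) cycle_verts_subset:
  assumes "is_cycle_of_length G l p" and "wf_digraph G"
  shows "cycle_verts G p \<subseteq> verts G"
proof -
  have "set p \<subseteq> arcs G"
    using assms(1) by (auto simp: is_cycle_of_length_def cycle_def awalk_def)
  then show ?thesis
    using wf_digraph.tail_in_verts[OF assms(2)] by (auto simp: cycle_verts_def)
qed

lemma (in pre_digraph) card_cycle_verts:
  assumes "is_cycle_of_length G l p"
  shows "card (cycle_verts G p) = l"
proof -
  obtain u where u: "awalk u p u" "distinct (tl (awalk_verts u p))" "p \<noteq> []"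
    using assms by (auto simp: is_cycle_of_length_def cycle_def)
  have cas: "cas u p u"
    using u(1) by (simp add: awalk_def)
  have "set (awalk_verts u p) = insert u (head G ` set p)"
    using awalk_verts_conv'[OF cas] cas u(3) by (cases p) simp_all
  moreover have "head G (last p) = u" if "cas v p u" for v
    using that u(3) by (induct v p u rule: cas.induct) (auto split: if_splits)
  then have "u \<in> head G ` set p"
    using cas u(3) by (metis imageI last_in_set)
  ultimately have "cycle_verts G p = set (tl (awalk_verts u p))"
    using cycle_verts_conv[OF u(1,3)] awalk_verts_conv'[OF cas] u(3)
    by (simp add: insert_absorb)
  then show ?thesis
    using assms distinct_card[OF u(2)]
    by (simp add: is_cycle_of_length_def length_awalk_verts)
qed

text \<open>As the cycles of a factor are disjoint, counting them shows that they cover all vertices.\<close>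

lemma is_cycle_factor_covers:
  assumes "fin_digraph G" and F: "is_cycle_factor G l F"
  shows "(\<Union>p\<in>F. cycle_verts G p) = verts G"
proof (rule card_subset_eq)
  interpret fin_digraph G by fact
  show "finite (verts G)" by simp
  show sub: "(\<Union>p\<in>F. cycle_verts G p) \<subseteq> verts G"
    using F cycle_verts_subset wf_digraph_axioms by (fastforce simp: is_cycle_factor_def)
  have "card (\<Union>p\<in>F. cycle_verts G p) = (\<Sum>p\<in>F. card (cycle_verts G p))"
    using F by (intro card_UN_disjoint) (auto simp: is_cycle_factor_def cycle_verts_def)
  also have "\<dots> = (\<Sum>p\<in>F. l)"
    using F card_cycle_verts by (intro sum.cong) (auto simp: is_cycle_factor_def)
  also have "\<dots> = card (verts G)"
    using F by (simp add: is_cycle_factor_def)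
  finally show "card (\<Union>p\<in>F. cycle_verts G p) = card (verts G)" .
qed

end

theory Submission
  imports Defs
begin

text \<open>
  A vertex without the element \<open>2k+1\<close> is a word of \<open>2k\<close> bits of height 0 (\<open>True\<close> counts \<open>+1\<close>,
  \<open>False\<close> counts \<open>-1\<close>); a vertex containing it is recorded by its complement, a word of \<open>2k\<close> bits of
  height 2. Two such words that differ in a single bit are adjacent vertices, and so are a word of
  height 0 and its complement. Every Dyck word \<open>x\<close> of length \<open>2k\<close> is now turned into its
  complement by flipping each bit exactly once, so that the heights alternate between 0 and 2; this
  gives a closed walk through \<open>2k+1\<close> vertices. For \<open>x = 1 u 0 v\<close> flip first the 0 after \<open>u\<close>, then
  treat \<open>u\<close> by the same procedure, complemented and reversed in time, then flip the first 1, and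
  finally treat \<open>v\<close>. The intermediate words \<open>1 m 1 v\<close> can be parsed uniquely, and so can the prefix
  of those words in which \<open>1 u 0\<close> is already complemented. Hence every word of height 0 or 2 arises from
  exactly one pair of Dyck word and time, so the cycles partition the vertices.
\<close>

section \<open>Dyck words and their stepwise complementation\<close>

datatype dtree = Leaf | Node dtree dtree

fun dyck :: "dtree \<Rightarrow> bool list" where
  "dyck Leaf = []"
| "dyck (Node u v) = True # dyck u @ False # dyck v"

text \<open>Between its two added ones the inner word contributes 2 - h to the height, so
  complementing it keeps heights in {0, 2}. Time must then run backwards: at t = 1 the inner state
  is the complemented end state, which is \<open>dyck u\<close> again.\<close>

fun state :: "dtree \<Rightarrow> nat \<Rightarrow> bool list" where
  "state Leaf t = []"
| "state (Node u v) t =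
    (if t = 0 then dyck (Node u v)
     else if t \<le> 2 * size u + 1
     then True # map Not (state u (2 * size u + 1 - t)) @ True # dyck v
     else False # map Not (dyck u) @ True # state v (t - (2 * size u + 2)))"

fun height :: "bool list \<Rightarrow> int" where
  "height [] = 0"
| "height (b # w) = (if b then 1 else -1) + height w"

lemma height_append [simp]: "height (v @ w) = height v + height w"
  by (induction v) auto

lemma height_Not [simp]: "height (map Not w) = - height w"
  by (induction w) auto

lemma Not_comp_Not [simp]: "Not \<circ> Not = id"
  by auto

lemma map_Not_Not: "map Not (map Not w) = w"
  by simp

lemma length_dyck [simp]: "length (dyck T) = 2 * size T"
  by (induction T) auto

lemma height_dyck [simp]: "height (dyck T) = 0"
  by (induction T) auto

lemma length_state [simp]: "length (state T t) = 2 * size T"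
  by (induction T arbitrary: t) auto

lemma state_0 [simp]: "state T 0 = dyck T"
  by (cases T) auto

lemma state_end [simp]: "state T (2 * size T) = map Not (dyck T)"
proof (induction T)
  case (Node u v)
  then show ?case by (simp add: algebra_simps)
qed simp

text \<open>In the middle phase the height is 2 minus that of the inner state, and the reversed
  index has the opposite parity to t.\<close>

lemma height_state: "t \<le> 2 * size T \<Longrightarrow> height (state T t) = (if even t then 0 else 2)"
proof (induction T arbitrary: t)
  case (Node u v)
  consider "t = 0" | "0 < t" "t \<le> 2 * size u + 1" | "2 * size u + 2 \<le> t" by linarith
  then show ?case
  proof cases
    case 2
    then have "even (2 * size u + 1 - t) = odd t" by simp
    with 2 Node.IH(1)[of "2 * size u + 1 - t"] show ?thesis by simp
  next
    case 3
    then have "even (t - (2 * size u + 2)) = even t" by simp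
    with 3 Node.IH(2)[of "t - (2 * size u + 2)"] Node.prems show ?thesis by simp
  qed simp
qed simp

section \<open>Unique parsing of Dyck words\<close>

lemma height_dyck_prefix: "dyck T = x @ y \<Longrightarrow> 0 \<le> height x"
proof (induction T arbitrary: x y)
  case (Node u v)
  show ?case
  proof (cases x)
    case (Cons b x')
    with Node.prems have b: "b" and *: "dyck u @ False # dyck v = x' @ y" by auto
    from * consider z where "dyck u = x' @ z"
      | z where "x' = dyck u @ z" "False # dyck v = z @ y"
      by (auto simp: append_eq_append_conv2)
    then show ?thesis
    proof cases
      case 1
      with Node.IH(1) b Cons show ?thesis by fastforce
    next
      case 2
      then show ?thesis using Node.IH(2) b Cons by (cases z) auto
    qed
  qed simp
qed simp

text \<open>The \<open>False\<close> closes the first prefix of height -1. If one Dyck word were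
  longer than the other, it would have such a prefix itself.\<close>

lemma dyck_prefix_code:
  assumes "dyck u @ False # x = dyck v @ False # y"
  shows "dyck u = dyck v \<and> x = y"
proof -
  have no_longer: False if "dyck u @ False # z = dyck v" for u v z
    using that height_dyck_prefix[of v "dyck u @ [False]" z] by simp
  from assms consider z where "dyck u = dyck v @ z" "z @ False # x = False # y"
    | z where "dyck u @ z = dyck v" "False # x = z @ False # y"
    unfolding append_eq_append_conv2 by blast
  then show ?thesis
  proof cases
    case 1
    then show ?thesis using no_longer[of v "tl z" u] by (cases z) auto
  next
    case 2
    then show ?thesis using no_longer[of u "tl z" v] by (cases z) auto
  qed
qed

lemma dyck_inject: "dyck u = dyck v \<Longrightarrow> u = v"
proof (induction u arbitrary: v)
  case Leaf
  then show ?case by (cases v) auto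
next
  case (Node a b)
  then show ?case by (cases v) (auto dest!: dyck_prefix_code)
qed

text \<open>If the two marked ones were at different positions, the equal heights of
  \<open>x\<close> and \<open>y\<close> would give the longer Dyck suffix a prefix of height
  -1.\<close>

lemma dyck_suffix_code:
  assumes "x @ True # dyck u = y @ True # dyck v" "height x = height y"
  shows "x = y \<and> u = v"
proof -
  have no_longer: False if "z @ True # w = dyck v" "1 + height z = 0" for z w v
    using height_dyck_prefix[OF that(1)[symmetric]] that(2) by simp
  from assms(1) consider z where "x = y @ z" "z @ True # dyck u = True # dyck v"
    | z where "x @ z = y" "True # dyck u = z @ True # dyck v"
    unfolding append_eq_append_conv2 by blast
  then show ?thesis
  proof cases
    case 1
    then show ?thesis
      using assms(2) no_longer[of "tl z" _ v] by (cases z) (auto dest: dyck_inject)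
  next
    case 2
    then show ?thesis
      using assms(2) no_longer[of "tl z" _ u] by (cases z) (auto dest: dyck_inject)
  qed
qed

section \<open>Each word of height 0 or 2 is a state exactly once\<close>

lemma map_Not_eq_iff [simp]: "map Not v = map Not w \<longleftrightarrow> v = w"
  by (metis map_Not_Not)

text \<open>The first bit separates the last phase from the others, and prefix heights separate the
  start from the middle phase. Within a phase, the parsing lemmas recover the subtree that is at
  rest and the state of the other.\<close>

lemma state_inject:
  assumes "state T t = state T' t'" "t \<le> 2 * size T" "t' \<le> 2 * size T'"
  shows "T = T' \<and> t = t'"
  using assms
proof (induction T arbitrary: T' t t')
  case Leaf
  then show ?case by (cases T') (auto split: if_splits)
next
  case (Node u v)
  from arg_cong[OF Node.prems(1), of length]
  have "size T' = Suc (size u + size v)" by (simp del: state.simps)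
  then obtain u' v' where T': "T' = Node u' v'" by (cases T') auto
  \<comment> \<open>A middle-phase word of height 0 has an inner state of height 2, hence a prefix
    of height 1 - 2 = -1, which no Dyck word has.\<close>
  have start_inner: False
    if "dyck (Node a b) = True # map Not (state c s) @ True # w" "s \<le> 2 * size c" "height w = 0"
    for a b c s w
  proof -
    have "height (dyck (Node a b)) = 2 - height (state c s)" using that(1,3) by simp
    with that(2) have "height (state c s) = 2" by simp
    with that(1) height_dyck_prefix[of "Node a b" "True # map Not (state c s)" "True # w"]
    show False by simp
  qed
  consider (start) "t = 0" | (inner) "0 < t" "t \<le> 2 * size u + 1" | (right) "2 * size u + 2 \<le> t"
    by linarith
  then show ?case
  proof cases
    case start
    then have *: "dyck (Node u v) = state T' t'" using Node.prems by simp
    have "t' = 0"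
    proof (rule ccontr)
      assume "t' \<noteq> 0"
      then have "2 * size u' + 1 - t' \<le> 2 * size u'" by simp
      with * T' \<open>t' \<noteq> 0\<close> show False
        using start_inner[of u v u' "2 * size u' + 1 - t'" "dyck v'"] by (auto split: if_splits)
    qed
    with start * show ?thesis by (metis dyck_inject state_0)
  next
    case inner
    let ?s = "2 * size u + 1 - t" and ?s' = "2 * size u' + 1 - t'"
    have *: "state T' t' = True # map Not (state u ?s) @ True # dyck v"
      using inner Node.prems by simp
    have "?s \<le> 2 * size u" using inner by simp
    have "t' \<noteq> 0"
    proof
      assume "t' = 0"
      with * T' have "dyck (Node u' v') = True # map Not (state u ?s) @ True # dyck v" by simp
      from start_inner[OF this \<open>?s \<le> 2 * size u\<close>] show False by simp
    qed
    moreover have t': "t' \<le> 2 * size u' + 1" using * T' \<open>t' \<noteq> 0\<close> by (auto split: if_splits)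
    ultimately have eq: "map Not (state u ?s) @ True # dyck v = map Not (state u' ?s') @ True # dyck v'"
      using * T' by simp
    from arg_cong[OF this, of height]
    have "height (map Not (state u ?s)) = height (map Not (state u' ?s'))" by simp
    from dyck_suffix_code[OF eq this] have "state u ?s = state u' ?s'" "v = v'" by simp_all
    moreover have "?s \<le> 2 * size u" "?s' \<le> 2 * size u'" using inner t' \<open>t' \<noteq> 0\<close> by simp_all
    ultimately have "u = u' \<and> ?s = ?s'" "v = v'" using Node.IH(1) by blast+
    with inner t' T' show ?thesis by auto
  next
    case right
    let ?s = "t - (2 * size u + 2)" and ?s' = "t' - (2 * size u' + 2)"
    have *: "state T' t' = False # map Not (dyck u) @ True # state v ?s"
      using right Node.prems by simp
    then have t': "2 * size u' + 2 \<le> t'" using T' by (auto split: if_splits)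
    with * T' have "map Not (dyck u) @ True # state v ?s = map Not (dyck u') @ True # state v' ?s'"
      by simp
    \<comment> \<open>Complementing turns the prefix into a Dyck word closed by
      \<open>False\<close>.\<close>
    from arg_cong[OF this, of "map Not"]
    have "dyck u @ False # map Not (state v ?s) = dyck u' @ False # map Not (state v' ?s')"
      by simp
    from dyck_prefix_code[OF this] have "u = u'" "state v ?s = state v' ?s'"
      using dyck_inject by auto
    moreover have "?s \<le> 2 * size v" "?s' \<le> 2 * size v'" using Node.prems(2,3) T' by simp_all
    ultimately have "u = u'" "v = v' \<and> ?s = ?s'" using Node.IH(2) by blast+
    with right t' T' show ?thesis by auto
  qed
qed

text \<open>The cut is made where the height first reaches -1. After a leading 1 this takes two
  descents: the first closes that 1, and the remainder still has negative height.\<close>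

lemma dyck_prefix_exists: "height w < 0 \<Longrightarrow> \<exists>u r. w = dyck u @ False # r"
proof (induction w rule: length_induct)
  case (1 w)
  then obtain b w' where w: "w = b # w'" by (cases w) auto
  show ?case
  proof (cases b)
    case True
    with 1 w obtain u r where u: "w' = dyck u @ False # r" by auto
    with 1(2) w True have "height r < 0" by simp
    with 1(1) w u obtain v s where "r = dyck v @ False # s" by fastforce
    with w u True have "w = dyck (Node u v) @ False # s" by simp
    then show ?thesis by blast
  next
    case False
    with w have "w = dyck Leaf @ False # w'" by simp
    then show ?thesis by blast
  qed
qed

text \<open>Peel off the first bit or a block \<open>1 u 0\<close> so that the rest keeps
  nonnegative height. A cut of the rest is also a cut of the whole word, so only a rest that is
  itself a Dyck word needs care.\<close>

lemma dyck_suffix_exists: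
  "0 \<le> height w \<Longrightarrow> (\<exists>v. w = dyck v) \<or> (\<exists>x v. w = x @ True # dyck v)"
proof (induction w rule: length_induct)
  case (1 w)
  then have IH: "(\<exists>v. r = dyck v) \<or> (\<exists>x v. r = x @ True # dyck v)"
    if "length r < length w" "0 \<le> height r" for r
    using that by blast
  have lift: ?case if "w = y @ r" "\<exists>x v. r = x @ True # dyck v" for y r
    using that by (metis append_assoc)
  show ?case
  proof (cases w)
    case Nil
    then show ?thesis by (metis dyck.simps(1))
  next
    case (Cons b w')
    consider "\<not> b" | "b" "0 \<le> height w'" | "b" "height w' < 0" by linarith
    then show ?thesis
    proof cases
      case 1
      with Cons \<open>0 \<le> height w\<close> have "0 < height w'" by simp
      with IH[of w'] Cons have "\<exists>x v. w' = x @ True # dyck v" by fastforce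
      with lift[of "[b]" w'] Cons show ?thesis by simp
    next
      case 2
      with IH[of w'] Cons consider v where "w' = dyck v" | "\<exists>x v. w' = x @ True # dyck v" by auto
      then show ?thesis
      proof cases
        case 1
        with Cons 2 have "w = [] @ True # dyck v" by simp
        then show ?thesis by blast
      qed (use lift[of "[b]" w'] Cons in simp)
    next
      case 3
      then obtain u r where r: "w' = dyck u @ False # r" using dyck_prefix_exists by blast
      with 3 Cons \<open>0 \<le> height w\<close> have "0 \<le> height r" by simp
      with IH[of r] Cons r consider v where "r = dyck v" | "\<exists>x v. r = x @ True # dyck v" by auto
      then show ?thesis
      proof cases
        case 1
        with Cons 3 r have "w = dyck (Node u v)" by simp
        then show ?thesis by blast
      qed (use lift[of "b # dyck u @ [False]" r] Cons r in simp)
    qed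
  qed
qed

text \<open>The first bit reveals the phase, and parsing leaves a shorter word of height 0 or 2,
  possibly after complementing, to which induction applies.\<close>

lemma state_surj:
  "height w \<in> {0, 2} \<Longrightarrow> \<exists>T t. w = state T t \<and> t \<le> 2 * size T"
proof (induction w rule: length_induct)
  case (1 w)
  then have IH: "\<exists>T t. r = state T t \<and> t \<le> 2 * size T"
    if "length r < length w" "height r \<in> {0, 2}" for r
    using that by blast
  show ?case
  proof (cases w)
    case Nil
    then have "w = state Leaf 0 \<and> 0 \<le> 2 * size Leaf" by simp
    then show ?thesis by blast
  next
    case (Cons b r)
    show ?thesis
    proof (cases b)
      case True
      from 1(2) Cons True have "height r \<in> {-1, 1}" by auto
      \<comment> \<open>A last unmatched 1 in the tail marks the middle phase; without one,
        \<open>w\<close> is a start word.\<close>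
      have "(\<exists>T. w = dyck T) \<or> (\<exists>x v. r = x @ True # dyck v)"
      proof (cases "height r < 0")
        case True
        then obtain u s where s: "r = dyck u @ False # s" using dyck_prefix_exists by blast
        with True \<open>height r \<in> {-1, 1}\<close> have "height s = 0" by auto
        with dyck_suffix_exists[of s] consider v where "s = dyck v" | x v where "s = x @ True # dyck v"
          by auto
        then show ?thesis
        proof cases
          case 1
          with Cons \<open>b\<close> s have "w = dyck (Node u v)" by simp
          then show ?thesis by blast
        next
          case 2
          with s have "r = (dyck u @ False # x) @ True # dyck v" by simp
          then show ?thesis by blast
        qed
      next
        case False
        with \<open>height r \<in> {-1, 1}\<close> have "height r = 1" by auto
        with dyck_suffix_exists[of r] show ?thesis by auto
      qed
      then consider T where "w = dyck T" | x v where "r = x @ True # dyck v" by blast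
      then show ?thesis
      proof cases
        case 1
        then have "w = state T 0 \<and> 0 \<le> 2 * size T" by simp
        then show ?thesis by blast
      next
        case 2
        with \<open>height r \<in> {-1, 1}\<close> have "height (map Not x) \<in> {0, 2}" by auto
        with IH[of "map Not x"] Cons 2 obtain u s where s: "map Not x = state u s" "s \<le> 2 * size u"
          by auto
        then have "x = map Not (state u s)" by (metis map_Not_Not)
        \<comment> \<open>The reversed clock is undone here; \<open>s\<close> being at most
          \<open>2 * size u\<close> makes the resulting time positive.\<close>
        with 2 Cons True s have "w = state (Node u v) (2 * size u + 1 - s)" by simp
        moreover have "2 * size u + 1 - s \<le> 2 * size (Node u v)" by simp
        ultimately show ?thesis by blast
      qed
    next
      case False
      with 1(2) Cons have r: "height r \<in> {1, 3}" by auto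
      then have "height (map Not r) < 0" by auto
      then obtain u s where "map Not r = dyck u @ False # s" using dyck_prefix_exists by blast
      from arg_cong[OF this, of "map Not"]
      have s: "r = map Not (dyck u) @ True # map Not s" by simp
      with r have "height (map Not s) \<in> {0, 2}" by auto
      with IH[of "map Not s"] Cons s obtain v t where "map Not s = state v t" "t \<le> 2 * size v"
        by auto
      with s Cons False have "w = state (Node u v) (t + (2 * size u + 2)) \<and>
        t + (2 * size u + 2) \<le> 2 * size (Node u v)" by simp
      then show ?thesis by blast
    qed
  qed
qed

section \<open>Consecutive states differ in a single bit\<close>

definition flip :: "bool list \<Rightarrow> bool list \<Rightarrow> bool" where
  "flip v w \<longleftrightarrow> (\<exists>x b y. v = x @ b # y \<and> w = x @ (\<not> b) # y)"

lemma flipI: "flip (x @ b # y) (x @ (\<not> b) # y)"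
  unfolding flip_def by blast

lemma flip_sym: "flip v w \<Longrightarrow> flip w v"
  unfolding flip_def by (elim exE conjE) (intro exI conjI, assumption, simp)

lemma flip_context: "flip v w \<Longrightarrow> flip (x @ v @ y) (x @ w @ y)"
  unfolding flip_def by (metis append.assoc append_Cons)

lemma flip_Not: "flip v w \<Longrightarrow> flip (map Not v) (map Not w)"
  unfolding flip_def by force

lemma flip_state: "t < 2 * size T \<Longrightarrow> flip (state T t) (state T (Suc t))"
proof (induction T arbitrary: t)
  case (Node u v)
  consider "t = 0" | "0 < t" "t \<le> 2 * size u" | "t = 2 * size u + 1" | "2 * size u + 2 \<le> t"
    by linarith
  then show ?case
  proof cases
    case 1
    then show ?thesis using flipI[of "True # dyck u" False "dyck v"] by simp
  next
    case 2
    \<comment> \<open>As the inner procedure runs backwards, \<open>Suc t\<close> uses the smaller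
      index, and the induction hypothesis is applied through \<open>flip_sym\<close>.\<close>
    let ?s = "2 * size u - t"
    have "2 * size u + 1 - t = Suc ?s" "2 * size u + 1 - Suc t = ?s" using 2 by auto
    moreover have "flip (state u (Suc ?s)) (state u ?s)"
      using 2 Node.IH(1)[of ?s] by (simp add: flip_sym)
    ultimately show ?thesis
      using 2 flip_context[OF flip_Not, of _ _ "[True]" "True # dyck v"] by simp
  next
    case 3
    then show ?thesis using flipI[of "[]" True "map Not (dyck u) @ True # dyck v"] by simp
  next
    case 4
    let ?s = "t - (2 * size u + 2)"
    have "Suc t - (2 * size u + 2) = Suc ?s" using 4 by simp
    moreover have "flip (state v ?s) (state v (Suc ?s))" using 4 Node by simp
    ultimately show ?thesis
      using 4 flip_context[of _ _ "False # map Not (dyck u) @ [True]" "[]"] by simp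
  qed
qed simp

section \<open>Bit words as vertices of the odd graph\<close>

definition ones :: "bool list \<Rightarrow> nat set" where
  "ones w = {Suc i |i. i < length w \<and> w ! i}"

definition vertex :: "bool list \<Rightarrow> nat set" where
  "vertex w = (if height w = 0 then ones w else insert (Suc (length w)) (ones (map Not w)))"

lemma Suc_in_ones_iff [simp]: "Suc i \<in> ones w \<longleftrightarrow> i < length w \<and> w ! i"
  by (simp add: ones_def)

lemma zero_notin_ones [simp]: "0 \<notin> ones w"
  by (simp add: ones_def)

lemma ones_subset: "ones w \<subseteq> {1..length w}"
  unfolding ones_def by auto

lemma finite_ones [simp]: "finite (ones w)"
  by (rule finite_subset[OF ones_subset]) simp

lemma ones_snoc: "ones (w @ [b]) = ones w \<union> (if b then {Suc (length w)} else {})"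
proof (rule set_eqI)
  show "x \<in> ones (w @ [b]) \<longleftrightarrow> x \<in> ones w \<union> (if b then {Suc (length w)} else {})" for x
    by (cases x) (auto simp: nth_append)
qed

lemma ones_inject:
  assumes "length v = length w" "ones v = ones w"
  shows "v = w"
proof (rule nth_equalityI)
  show "v ! i = w ! i" if "i < length v" for i
    using that assms Suc_in_ones_iff[of i v] Suc_in_ones_iff[of i w] by simp
qed fact

lemma height_card_ones: "height w = 2 * int (card (ones w)) - int (length w)"
proof (induction w rule: rev_induct)
  case Nil
  then show ?case by (simp add: ones_def)
next
  case (snoc b w)
  then show ?case by (simp add: ones_snoc)
qed

text \<open>The element \<open>Suc (length w)\<close> shows whether the word or its complement was
  recorded; removing it leaves the positions of the ones.\<close>

lemma vertex_inject:
  assumes "vertex v = vertex w" "length v = length w"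
  shows "v = w"
proof -
  have last: "Suc (length w) \<in> vertex w \<longleftrightarrow> height w \<noteq> 0" for w
    by (simp add: vertex_def)
  have rest: "vertex w - {Suc (length w)} = ones (if height w = 0 then w else map Not w)" for w
    by (simp add: vertex_def)
  have "height v = 0 \<longleftrightarrow> height w = 0" using last[of v] last[of w] assms by simp
  then have "(if height v = 0 then v else map Not v) = (if height v = 0 then w else map Not w)"
    using rest[of v] rest[of w] assms by (intro ones_inject) simp_all
  then show ?thesis by (simp split: if_splits)
qed

lemma vertex_in_odd_graph:
  assumes "length w = 2 * k" "height w \<in> {0, 2}"
  shows "vertex w \<in> pverts (odd_graph k)"
proof -
  have "card (vertex w) = k"
  proof (cases "height w = 0")
    case True
    with assms height_card_ones[of w] show ?thesis by (simp add: vertex_def)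
  next
    case False
    \<comment> \<open>The complement of a word of height 2 has k - 1 ones; the added element makes
      k.\<close>
    with assms height_card_ones[of "map Not w"] show ?thesis by (simp add: vertex_def)
  qed
  moreover have "vertex w \<subseteq> {1..2 * k + 1}"
    using ones_subset[of w] ones_subset[of "map Not w"] assms(1) by (auto simp: vertex_def)
  ultimately show ?thesis by (simp add: odd_graph_def)
qed

lemma vertex_surj:
  assumes "A \<in> pverts (odd_graph k)"
  shows "\<exists>w. length w = 2 * k \<and> height w \<in> {0, 2} \<and> A = vertex w"
proof -
  have A: "A \<subseteq> {1..2 * k + 1}" "card A = k" using assms by (auto simp: odd_graph_def)
  define v where "v = map (\<lambda>i. Suc i \<in> A) [0..<2 * k]"
  have len: "length v = 2 * k" by (simp add: v_def)
  have ones_v: "ones v = A - {Suc (2 * k)}"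
  proof -
    have "x \<in> ones v \<longleftrightarrow> x \<in> A - {Suc (2 * k)}" for x
      using A(1) by (cases x) (auto simp: ones_def v_def)
    then show ?thesis by blast
  qed
  show ?thesis
  proof (cases "Suc (2 * k) \<in> A")
    case True
    \<comment> \<open>The other k - 1 elements form a word of height -2, so its complement is the
      word sought.\<close>
    with A ones_v have "int (card (ones v)) = int k - 1"
      by (metis card_Suc_Diff1 finite_atLeastAtMost finite_subset of_nat_Suc add_diff_cancel_left')
    with len have h: "height (map Not v) = 2" by (simp add: height_card_ones[of v])
    then have "vertex (map Not v) = insert (Suc (2 * k)) (ones v)"
      unfolding vertex_def by (simp only: map_Not_Not) (simp add: len)
    with ones_v True have "A = vertex (map Not v)" by auto
    with h len show ?thesis by (intro exI[of _ "map Not v"]) simp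
  next
    case False
    with ones_v A have "ones v = A" "height v = 0" by (auto simp: height_card_ones[of v] len)
    with len show ?thesis by (intro exI[of _ v]) (simp add: vertex_def)
  qed
qed

lemma ones_disjoint_Not: "ones w \<inter> ones (map Not w) = {}"
  unfolding ones_def by auto

text \<open>Going from height 0 to height 2 adds a one, so the ones of the lower word avoid the
  zeros of the upper word, and only the upper vertex contains the last element.\<close>

lemma vertex_flip_disjoint:
  assumes "flip v w" "height v \<in> {0, 2}" "height w \<in> {0, 2}"
  shows "vertex v \<inter> vertex w = {}"
proof -
  have *: "vertex v \<inter> vertex w = {}"
    if "flip v w" "height v = 0" "height w = 2" for v w
  proof -
    obtain x b y where v: "v = x @ b # y" and w: "w = x @ (\<not> b) # y"
      using \<open>flip v w\<close> unfolding flip_def by blast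
    with that have "\<not> b" by (auto split: if_splits)
    with v w have "ones v \<subseteq> ones w" by (auto simp: ones_def nth_append nth_Cons')
    moreover have "length v = length w" using v w by simp
    ultimately show ?thesis
      using that ones_disjoint_Not[of w] by (auto simp: vertex_def)
  qed
  \<comment> \<open>A flip changes the height by 2, so exactly one of the words has height
    0.\<close>
  have "height v \<noteq> height w" using assms(1) by (auto simp: flip_def split: if_splits)
  with assms *[of v w] *[of w v] show ?thesis by (auto simp: flip_sym Int_commute)
qed

section \<open>Building cycles and cycle factors\<close>

lemma cycle_of_closed_sequence:
  fixes G :: "'a pair_pre_digraph" and f :: "nat \<Rightarrow> 'a" and n :: nat
  defines "p \<equiv> map (\<lambda>t. (f t, f (Suc t))) [0..<n]"
  assumes "3 \<le> n" and arcs: "\<And>t. t < n \<Longrightarrow> (f t, f (Suc t)) \<in> parcs G"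
    and closed: "f n = f 0" and inj: "inj_on f {..<n}" and "f 0 \<in> pverts G"
  shows "is_cycle_of_length (with_proj G) n p" and "cycle_verts (with_proj G) p = f ` {..<n}"
proof -
  interpret pre_digraph "with_proj G" .
  have walk: "cas (f i) (map (\<lambda>t. (f t, f (Suc t))) [i..<i + m]) (f (i + m)) \<and>
    awalk_verts (f i) (map (\<lambda>t. (f t, f (Suc t))) [i..<i + m]) = map f [i..<Suc (i + m)]" for i m
  proof (induction m arbitrary: i)
    case (Suc m)
    from Suc[of "Suc i"] show ?case by (simp add: upt_conv_Cons del: upt_Suc)
  qed simp
  \<comment> \<open>A cycle requires distinct vertices after the first, that is \<open>f 1\<close>
    to \<open>f n\<close>; replacing index n by 0 reduces this to \<open>inj\<close>.\<close>
  have "inj_on f {Suc 0..<Suc n}"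
  proof (rule inj_onI)
    fix a b assume *: "a \<in> {Suc 0..<Suc n}" "b \<in> {Suc 0..<Suc n}" "f a = f b"
    have "f (if a = n then 0 else a) = f (if b = n then 0 else b)" using * closed by auto
    with inj have "(if a = n then 0 else a) = (if b = n then 0 else b)"
      by (rule inj_onD) (use * in auto)
    with * show "a = b" by (auto split: if_splits)
  qed
  then have "distinct (tl (awalk_verts (f 0) p))"
    using walk[of 0 n] by (simp add: p_def map_tl[symmetric] tl_upt distinct_map del: upt_Suc)
  moreover have "awalk (f 0) p (f 0)"
    using walk[of 0 n] closed arcs \<open>f 0 \<in> pverts G\<close> by (auto simp: awalk_def p_def)
  moreover have "p \<noteq> []" using \<open>3 \<le> n\<close> by (simp add: p_def)
  ultimately show "is_cycle_of_length (with_proj G) n p"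
    using \<open>3 \<le> n\<close> by (auto simp: is_cycle_of_length_def cycle_def p_def)
  show "cycle_verts (with_proj G) p = f ` {..<n}"
    by (simp add: cycle_verts_def p_def image_image atLeast0LessThan)
qed

text \<open>Covering replaces counting: disjoint nonempty vertex sets determine their cycles, so
  \<open>F\<close> is finite, and summing the sizes \<open>l\<close> gives the number of
  cycles.\<close>

lemma is_cycle_factorI:
  assumes "finite (verts G)" "0 < l"
    and cyc: "\<And>p. p \<in> F \<Longrightarrow> is_cycle_of_length G l p"
    and disj: "\<And>p q. p \<in> F \<Longrightarrow> q \<in> F \<Longrightarrow> p \<noteq> q \<Longrightarrow> cycle_verts G p \<inter> cycle_verts G q = {}"
    and cover: "(\<Union>p\<in>F. cycle_verts G p) = verts G"
  shows "is_cycle_factor G l F"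
proof -
  have card: "card (cycle_verts G p) = l" if "p \<in> F" for p
    using pre_digraph.card_cycle_verts cyc that by blast
  have fin: "finite (cycle_verts G p)" for p by (simp add: cycle_verts_def)
  have "inj_on (cycle_verts G) F"
    using disj card \<open>0 < l\<close> by (metis Int_absorb card.empty inj_onI less_irrefl)
  moreover have "finite (cycle_verts G ` F)"
    using cover \<open>finite (verts G)\<close> by (intro finite_UnionD) simp
  ultimately have "finite F" using finite_imageD by blast
  have "card (verts G) = (\<Sum>p\<in>F. card (cycle_verts G p))"
    unfolding cover[symmetric] using \<open>finite F\<close> fin disj by (intro card_UN_disjoint) auto
  then have "card (verts G) = card F * l" using card by simp
  with \<open>finite F\<close> \<open>0 < l\<close> cyc disj show ?thesis by (simp add: is_cycle_factor_def)
qed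

section \<open>Assembling the factor from all Dyck words of length 2k\<close>

theorem theorem4:
  fixes k :: nat
  assumes "k \<ge> 1"
  shows "has_cycle_factor (with_proj (odd_graph k)) (2 * k + 1)"
proof -
  let ?G = "with_proj (odd_graph k)"
  \<comment> \<open>The default 0 makes \<open>f T (2 * k + 1)\<close> equal to
    \<open>f T 0\<close>, which closes the walk.\<close>
  define f where "f T t = vertex (state T (if t \<le> 2 * k then t else 0))" for T t
  define c where "c T = map (\<lambda>t. (f T t, f T (Suc t))) [0..<2 * k + 1]" for T
  interpret pair_graph "odd_graph k" using pair_graph_odd_graph[OF assms] .
  have height: "height (state T t) \<in> {0, 2}" if "size T = k" "t \<le> 2 * k" for T t
    using that height_state[of t T] by simp
  have vert: "f T t \<in> pverts (odd_graph k)" if "size T = k" for T t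
    unfolding f_def using that by (intro vertex_in_odd_graph height) auto
  have inject: "T = T' \<and> t = t'"
    if "f T t = f T' t'" "size T = k" "size T' = k" "t \<le> 2 * k" "t' \<le> 2 * k" for T T' t t'
    using that by (intro state_inject vertex_inject) (auto simp: f_def)
  have arc: "(f T t, f T (Suc t)) \<in> parcs (odd_graph k)" if "size T = k" "t < 2 * k + 1" for T t
  proof -
    have "f T t \<inter> f T (Suc t) = {}"
    \<comment> \<open>The closing arc is not a flip: it joins the complemented Dyck word to the Dyck
      word, both of height 0.\<close>
    proof (cases "t = 2 * k")
      case True
      with \<open>size T = k\<close> have "state T t = map Not (dyck T)" using state_end[of T] by simp
      with True show ?thesis using ones_disjoint_Not[of "dyck T"] by (auto simp: f_def vertex_def)
    next
      case False
      with that have "t < 2 * k" by simp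
      with that have "vertex (state T t) \<inter> vertex (state T (Suc t)) = {}"
        by (intro vertex_flip_disjoint flip_state height) auto
      with \<open>t < 2 * k\<close> show ?thesis by (simp add: f_def)
    qed
    with vert[OF \<open>size T = k\<close>] show ?thesis by (simp add: odd_graph_def Let_def)
  qed
  have c: "is_cycle_of_length ?G (2 * k + 1) (c T)" "cycle_verts ?G (c T) = f T ` {..<2 * k + 1}"
    if "size T = k" for T
    unfolding c_def
  proof -
    have inj: "inj_on (f T) {..<2 * k + 1}" using inject that by (intro inj_onI) auto
    have closed: "f T (2 * k + 1) = f T 0" by (simp add: f_def)
    have "3 \<le> 2 * k + 1" using assms by simp
    note * = cycle_of_closed_sequence[OF this arc[OF that] closed inj vert[OF that]]
    from * show "is_cycle_of_length ?G (2 * k + 1) (map (\<lambda>t. (f T t, f T (Suc t))) [0..<2 * k + 1])"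
      "cycle_verts ?G (map (\<lambda>t. (f T t, f T (Suc t))) [0..<2 * k + 1]) = f T ` {..<2 * k + 1}"
      by blast+
  qed
  have "is_cycle_factor ?G (2 * k + 1) (c ` {T. size T = k})"
  proof (rule is_cycle_factorI)
    show "cycle_verts ?G p \<inter> cycle_verts ?G q = {}"
      if "p \<in> c ` {T. size T = k}" "q \<in> c ` {T. size T = k}" "p \<noteq> q" for p q
    proof -
      from that obtain T T' where T: "p = c T" "size T = k" and T': "q = c T'" "size T' = k"
        by blast
      with \<open>p \<noteq> q\<close> have "f T t \<noteq> f T' t'" if "t \<le> 2 * k" "t' \<le> 2 * k" for t t'
        using that inject by blast
      with T T' show ?thesis by (auto simp: c(2))
    qed
    show "(\<Union>p\<in>c ` {T. size T = k}. cycle_verts ?G p) = verts ?G"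
    proof (intro equalityI subsetI)
      fix A assume "A \<in> verts ?G"
      then obtain w where w: "length w = 2 * k" "height w \<in> {0, 2}" "A = vertex w"
        using vertex_surj by auto
      with state_surj obtain T t where T: "w = state T t" "t \<le> 2 * size T" by blast
      with w have "size T = k" by simp
      moreover from T w this have "A = f T t" "t < 2 * k + 1" by (auto simp: f_def)
      ultimately show "A \<in> (\<Union>p\<in>c ` {T. size T = k}. cycle_verts ?G p)" by (auto simp: c(2))
    qed (use c(2) vert in auto)
  qed (use c(1) in auto)
  then show ?thesis unfolding has_cycle_factor_def by blast
qed

end
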